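(* Let $(X,P_X)$ and $(B,P_B)$ be right-preordered groups with positive cones $P_X$ and $P_B$, let $\varphi\colon B\to\mathrm{Aut}(X)$, $b\mapsto\varphi_b$, be an action of the group $B$ on the group $X$ by group automorphisms, and consider the split extension of groups $$X\xrightarrow{\langle 1,0\rangle} X\rtimes_\varphi B \underset{\langle 0,1\rangle}{\overset{\pi_B}{\rightleftarrows}} B .$$ The following conditions are equivalent: (i) $P_{\mathrm{lex}}=\{(x,b)\in X\rtimes_\varphi B \mid b>0 \text{ or } (b\sim 0 \text{ and } x\geq 0)\}$ is (the positive cone of) a compatible right-preorder on $X\rtimes_\varphi B$; (ii) there is a compatible right-preorder $P$ on $X\rtimes_\varphi B$; (iii) for every $b\in P_B$, if there exists $b'\in P_B$ with $b+b'\sim 0$, then $\varphi_b\colon X\to X$ is monotone.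
   Context: Groups are written additively but need not be abelian. A right-preordered group is a group $X$ with a preorder (reflexive and transitive relation) $\leq$ such that $x\leq y$ implies $x+z\leq y+z$ for all $x,y,z\in X$. Its positive cone is the submonoid $P_X=\{x\in X\mid x\geq 0\}$; right-preorders on a group correspond bijectively to submonoids via $x\leq y\Leftrightarrow y-x\in P_X$, and a right-preorder is identified with its positive cone. $\mathbf{ROrdGrp}$ is the category of right-preordered groups and monotone group homomorphisms. We write $b\sim 0$ for ($b\leq 0$ and $0\leq b$), and $b>0$ for ($b\geq 0$ and not $b\sim 0$). The semidirect product $X\rtimes_\varphi B$ is the set $X\times B$ with operation $(x,b)+(y,b')=(x+\varphi_b(y),b+b')$; $\langle 1,0\rangle(x)=(x,0)$, $\pi_B(x,b)=b$, $\langle 0,1\rangle(b)=(0,b)$. A right-preorder on the group $X\rtimes_\varphi B$ (equivalently, a submonoid $P$) is called compatible if it makes this diagram a split extension in $\mathbf{ROrdGrp}$, i.e. $\pi_B$ and $\langle 0,1\rangle$ are monotone and $\langle 1,0\rangle$ is the kernel of $\pi_B$ in $\mathbf{ROrdGrp}$ (the latter meaning that $(x,0)\in P$ if and only if $x\in P_X$). *)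

theory Defs
  imports "HOL-Algebra.Bij" "HOL-Algebra.Coset"
begin

text \<open>
  Groups are groups in the sense of HOL-Algebra, hence written multiplicatively:
  \<open>x \<otimes> y\<close> and \<open>\<one>\<close> stand for \<open>x + y\<close> and \<open>0\<close>. They need not be abelian.
  A preorder is a set of pairs, with \<open>(x, y) \<in> r\<close> standing for \<open>x \<le> y\<close>.
\<close>

section \<open>Right-preordered groups\<close>

definition right_preorder :: "('a, 'm) monoid_scheme \<Rightarrow> 'a rel \<Rightarrow> bool" where
  "right_preorder G r \<longleftrightarrow>
     preorder_on (carrier G) r \<and>
     (\<forall>x\<in>carrier G. \<forall>y\<in>carrier G. \<forall>z\<in>carrier G.
        (x, y) \<in> r \<longrightarrow> (x \<otimes>\<^bsub>G\<^esub> z, y \<otimes>\<^bsub>G\<^esub> z) \<in> r)"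

definition right_preordered_group :: "('a, 'm) monoid_scheme \<Rightarrow> 'a rel \<Rightarrow> bool" where
  "right_preordered_group G r \<longleftrightarrow> group G \<and> right_preorder G r"

definition pos_cone :: "('a, 'm) monoid_scheme \<Rightarrow> 'a rel \<Rightarrow> 'a set" where
  "pos_cone G r = {x \<in> carrier G. (\<one>\<^bsub>G\<^esub>, x) \<in> r}"

definition equiv_zero :: "('a, 'm) monoid_scheme \<Rightarrow> 'a rel \<Rightarrow> 'a \<Rightarrow> bool" where
  "equiv_zero G r b \<longleftrightarrow> (b, \<one>\<^bsub>G\<^esub>) \<in> r \<and> (\<one>\<^bsub>G\<^esub>, b) \<in> r"

definition strictly_pos :: "('a, 'm) monoid_scheme \<Rightarrow> 'a rel \<Rightarrow> 'a \<Rightarrow> bool" where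
  "strictly_pos G r b \<longleftrightarrow> (\<one>\<^bsub>G\<^esub>, b) \<in> r \<and> \<not> equiv_zero G r b"

section \<open>The category of right-preordered groups\<close>

definition monotone_map ::
  "('a, 'm) monoid_scheme \<Rightarrow> 'a rel \<Rightarrow> 'b rel \<Rightarrow> ('a \<Rightarrow> 'b) \<Rightarrow> bool" where
  "monotone_map G leG leH f \<longleftrightarrow>
     (\<forall>x\<in>carrier G. \<forall>y\<in>carrier G. (x, y) \<in> leG \<longrightarrow> (f x, f y) \<in> leH)"

definition rordgrp_hom ::
  "('a, 'm) monoid_scheme \<Rightarrow> 'a rel \<Rightarrow> ('b, 'n) monoid_scheme \<Rightarrow> 'b rel \<Rightarrow> ('a \<Rightarrow> 'b) set" where
  "rordgrp_hom G leG H leH = {f \<in> hom G H. monotone_map G leG leH f}"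

text \<open>
  The map \<open>k : K \<rightarrow> G\<close> is a kernel of \<open>p : G \<rightarrow> H\<close> in the category: it is a kernel of groups and
  \<open>K\<close> carries the preorder induced from \<open>G\<close>, expressed through the positive cones.
\<close>

definition rordgrp_kernel ::
  "('a, 'm) monoid_scheme \<Rightarrow> 'a rel \<Rightarrow> ('b, 'n) monoid_scheme \<Rightarrow> 'b rel \<Rightarrow>
   ('c, 'o) monoid_scheme \<Rightarrow> ('a \<Rightarrow> 'b) \<Rightarrow> ('b \<Rightarrow> 'c) \<Rightarrow> bool" where
  "rordgrp_kernel K leK G leG H k p \<longleftrightarrow>
     k \<in> hom K G \<and> inj_on k (carrier K) \<and> k ` carrier K = kernel G H p \<and>
     (\<forall>x\<in>carrier K. k x \<in> pos_cone G leG \<longleftrightarrow> x \<in> pos_cone K leK)"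

definition rordgrp_split_extension ::
  "('a, 'm) monoid_scheme \<Rightarrow> 'a rel \<Rightarrow> ('b, 'n) monoid_scheme \<Rightarrow> 'b rel \<Rightarrow>
   ('c, 'o) monoid_scheme \<Rightarrow> 'c rel \<Rightarrow> ('a \<Rightarrow> 'b) \<Rightarrow> ('b \<Rightarrow> 'c) \<Rightarrow> ('c \<Rightarrow> 'b) \<Rightarrow> bool" where
  "rordgrp_split_extension X leX G leG B leB k p s \<longleftrightarrow>
     right_preordered_group X leX \<and> right_preordered_group G leG \<and>
     right_preordered_group B leB \<and>
     p \<in> rordgrp_hom G leG B leB \<and> s \<in> rordgrp_hom B leB G leG \<and>
     (\<forall>b\<in>carrier B. p (s b) = b) \<and>
     rordgrp_kernel X leX G leG B k p"

section \<open>Semidirect products\<close>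

definition group_action_by_auts ::
  "('b, 'n) monoid_scheme \<Rightarrow> ('a, 'm) monoid_scheme \<Rightarrow> ('b \<Rightarrow> 'a \<Rightarrow> 'a) \<Rightarrow> bool" where
  "group_action_by_auts B X \<phi> \<longleftrightarrow> \<phi> \<in> hom B (AutoGroup X)"

definition semidirect_product ::
  "('a, 'm) monoid_scheme \<Rightarrow> ('b, 'n) monoid_scheme \<Rightarrow> ('b \<Rightarrow> 'a \<Rightarrow> 'a) \<Rightarrow> ('a \<times> 'b) monoid" where
  "semidirect_product X B \<phi> =
     \<lparr>carrier = carrier X \<times> carrier B,
      mult = (\<lambda>(x, b) (y, b'). (x \<otimes>\<^bsub>X\<^esub> \<phi> b y, b \<otimes>\<^bsub>B\<^esub> b')),
      one = (\<one>\<^bsub>X\<^esub>, \<one>\<^bsub>B\<^esub>)\<rparr>"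

definition compatible ::
  "('a, 'm) monoid_scheme \<Rightarrow> 'a rel \<Rightarrow> ('b, 'n) monoid_scheme \<Rightarrow> 'b rel \<Rightarrow>
   ('b \<Rightarrow> 'a \<Rightarrow> 'a) \<Rightarrow> ('a \<times> 'b) rel \<Rightarrow> bool" where
  "compatible X leX B leB \<phi> r \<longleftrightarrow>
     rordgrp_split_extension X leX (semidirect_product X B \<phi>) r B leB
       (\<lambda>x. (x, \<one>\<^bsub>B\<^esub>)) snd (\<lambda>b. (\<one>\<^bsub>X\<^esub>, b))"

definition P_lex ::
  "('a, 'm) monoid_scheme \<Rightarrow> 'a rel \<Rightarrow> ('b, 'n) monoid_scheme \<Rightarrow> 'b rel \<Rightarrow>
   ('b \<Rightarrow> 'a \<Rightarrow> 'a) \<Rightarrow> ('a \<times> 'b) set" where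
  "P_lex X leX B leB \<phi> =
     {(x, b) \<in> carrier (semidirect_product X B \<phi>).
        strictly_pos B leB b \<or> (equiv_zero B leB b \<and> (\<one>\<^bsub>X\<^esub>, x) \<in> leX)}"

end

theory Submission
  imports Defs
begin

text \<open>
  In terms of cones, \<open>b \<sim> 0\<close> says that both \<open>b\<close> and its inverse are positive, and the hypothesis
  on \<open>b\<close> in (iii) says exactly \<open>b \<sim> 0\<close>. For such \<open>b\<close> and a compatible \<open>P\<close>, both \<open>(0, b)\<close> and
  its inverse lie in \<open>P\<close>, so conjugation by \<open>(0, b)\<close>, which restricts to \<open>\<phi>\<^sub>b\<close> on \<open>X\<close>, preserves
  \<open>P \<inter> X = P\<^sub>X\<close>. Conversely, monotonicity of these \<open>\<phi>\<^sub>b\<close> is what closes \<open>P\<^sub>l\<^sub>e\<^sub>x\<close> under sums of elements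
  whose second coordinates are both equivalent to zero; in all other cases the sum has strictly
  positive second coordinate.
\<close>

section \<open>Positive cones\<close>

lemma (in group) inv_cancel_left:
  assumes "x \<in> carrier G" "y \<in> carrier G"
  shows "inv x \<otimes> (x \<otimes> y) = y" "x \<otimes> (inv x \<otimes> y) = y"
  using assms by (simp_all flip: m_assoc)

lemma pos_cone_carrier: "x \<in> pos_cone G r \<Longrightarrow> x \<in> carrier G"
  by (simp add: pos_cone_def)

text \<open>Right translation by \<open>inv x\<close> sends the pair \<open>(x, y)\<close> to
  \<open>(\<one>, y \<otimes> inv x)\<close>, and translation by \<open>x\<close> goes back. This
  lets later arguments work with cones only.\<close>

lemma right_preorder_iff_pos_cone:
  assumes "group G" "right_preorder G r" "x \<in> carrier G" "y \<in> carrier G"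
  shows "(x, y) \<in> r \<longleftrightarrow> y \<otimes>\<^bsub>G\<^esub> inv\<^bsub>G\<^esub> x \<in> pos_cone G r"
proof -
  interpret group G by fact
  have tr: "(u \<otimes>\<^bsub>G\<^esub> w, v \<otimes>\<^bsub>G\<^esub> w) \<in> r"
    if "(u, v) \<in> r" "u \<in> carrier G" "v \<in> carrier G" "w \<in> carrier G" for u v w
    using assms(2) that unfolding right_preorder_def by blast
  show ?thesis
    using tr[of x y "inv\<^bsub>G\<^esub> x"] tr[of "\<one>\<^bsub>G\<^esub>" "y \<otimes>\<^bsub>G\<^esub> inv\<^bsub>G\<^esub> x" x] assms(3,4)
    by (auto simp: pos_cone_def m_assoc)
qed

lemma submonoid_pos_cone:
  assumes "group G" "right_preorder G r"
  shows "submonoid (pos_cone G r) G"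
proof -
  interpret group G by fact
  have r: "refl_on (carrier G) r" "trans r"
    using assms(2) by (auto simp: right_preorder_def preorder_on_def)
  show ?thesis
  proof
    fix x y assume xy: "x \<in> pos_cone G r" "y \<in> pos_cone G r"
    then have c: "x \<in> carrier G" "y \<in> carrier G" and y: "(\<one>\<^bsub>G\<^esub>, y) \<in> r"
      by (auto simp: pos_cone_def)
    \<comment> \<open>The quotient of \<open>x \<otimes> y\<close> by \<open>y\<close> is
      \<open>x\<close>, which is positive. Transitivity through \<open>y\<close> then gives
      closure.\<close>
    have "(y, x \<otimes>\<^bsub>G\<^esub> y) \<in> r"
      using right_preorder_iff_pos_cone[OF assms, of y "x \<otimes>\<^bsub>G\<^esub> y"] xy c by (simp add: m_assoc)
    with y r(2) c show "x \<otimes>\<^bsub>G\<^esub> y \<in> pos_cone G r"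
      by (auto simp: pos_cone_def dest: transD)
  qed (use r(1) in \<open>auto simp: pos_cone_def refl_on_def\<close>)
qed

lemma equiv_zero_iff_pos_cone:
  assumes "group G" "right_preorder G r" "b \<in> carrier G"
  shows "equiv_zero G r b \<longleftrightarrow> b \<in> pos_cone G r \<and> inv\<^bsub>G\<^esub> b \<in> pos_cone G r"
proof -
  interpret group G by fact
  show ?thesis
    using right_preorder_iff_pos_cone[OF assms(1,2), of b "\<one>\<^bsub>G\<^esub>"]
      right_preorder_iff_pos_cone[OF assms(1,2), of "\<one>\<^bsub>G\<^esub>" b] assms(3)
    by (auto simp: equiv_zero_def)
qed

text \<open>If a product of positive elements is invertible within the cone, so is each factor:
  multiplying the inverse of the product by the other factor, on the suitable side, leaves the
  inverse sought. This serves both to simplify condition (iii) and to close \<open>P_lex\<close>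
  under products.\<close>

lemma pos_cone_inv_of_mult:
  assumes "group G" "right_preorder G r" "b \<in> pos_cone G r" "b' \<in> pos_cone G r"
    and "inv\<^bsub>G\<^esub> (b \<otimes>\<^bsub>G\<^esub> b') \<in> pos_cone G r"
  shows "inv\<^bsub>G\<^esub> b \<in> pos_cone G r" "inv\<^bsub>G\<^esub> b' \<in> pos_cone G r"
proof -
  interpret group G by fact
  note c = assms(3,4)[THEN pos_cone_carrier]
  note m_closed = submonoid.m_closed[OF submonoid_pos_cone[OF assms(1,2)]]
  have "b' \<otimes>\<^bsub>G\<^esub> inv\<^bsub>G\<^esub> (b \<otimes>\<^bsub>G\<^esub> b') = inv\<^bsub>G\<^esub> b"
    using c by (simp add: inv_mult_group inv_cancel_left)
  then show "inv\<^bsub>G\<^esub> b \<in> pos_cone G r"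
    using m_closed[OF assms(4,5)] by simp
  have "inv\<^bsub>G\<^esub> (b \<otimes>\<^bsub>G\<^esub> b') \<otimes>\<^bsub>G\<^esub> b = inv\<^bsub>G\<^esub> b'"
    using c by (simp add: inv_mult_group m_assoc)
  then show "inv\<^bsub>G\<^esub> b' \<in> pos_cone G r"
    using m_closed[OF assms(5,3)] by simp
qed

lemma monotone_map_iff_pos_cone:
  assumes "group G" "right_preorder G r" "group H" "right_preorder H q" "f \<in> hom G H"
  shows "monotone_map G r q f \<longleftrightarrow> f ` pos_cone G r \<subseteq> pos_cone H q"
proof -
  interpret group_hom G H f
    using assms by (simp add: group_hom_def group_hom_axioms_def)
  \<comment> \<open>A homomorphism respects quotients, so both relations become cone membership, of
    one quotient and of its image.\<close>
  have iff: "(x, y) \<in> r \<longleftrightarrow> y \<otimes>\<^bsub>G\<^esub> inv\<^bsub>G\<^esub> x \<in> pos_cone G r"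
    "(f x, f y) \<in> q \<longleftrightarrow> f (y \<otimes>\<^bsub>G\<^esub> inv\<^bsub>G\<^esub> x) \<in> pos_cone H q"
    if "x \<in> carrier G" "y \<in> carrier G" for x y
    using that right_preorder_iff_pos_cone[OF assms(1,2)] right_preorder_iff_pos_cone[OF assms(3,4)]
    by simp_all
  show ?thesis
  proof
    assume "monotone_map G r q f"
    then show "f ` pos_cone G r \<subseteq> pos_cone H q"
      by (force simp: monotone_map_def pos_cone_def)
  next
    assume "f ` pos_cone G r \<subseteq> pos_cone H q"
    then show "monotone_map G r q f"
      unfolding monotone_map_def using iff by blast
  qed
qed

text \<open>The inverse of \<open>pos_cone\<close> in the correspondence between right-preorders and
  submonoids; it turns \<open>P_lex\<close> into the relation that witnesses (i). The restriction to
  the carrier is what \<open>preorder_on\<close> demands.\<close>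

definition cone_order :: "('a, 'm) monoid_scheme \<Rightarrow> 'a set \<Rightarrow> 'a rel" where
  "cone_order G P = {(x, y). x \<in> carrier G \<and> y \<in> carrier G \<and> y \<otimes>\<^bsub>G\<^esub> inv\<^bsub>G\<^esub> x \<in> P}"

text \<open>The unit of \<open>P\<close> gives reflexivity, closure gives transitivity because
  quotients telescope, and right invariance holds because the common right factor cancels in the
  quotient.\<close>

lemma
  assumes "group G" "submonoid P G"
  shows right_preorder_cone_order: "right_preorder G (cone_order G P)"
    and pos_cone_cone_order: "pos_cone G (cone_order G P) = P"
proof -
  interpret group G by fact
  interpret P: submonoid P G by fact
  have "trans (cone_order G P)"
  proof (rule transI)
    fix x y z assume a: "(x, y) \<in> cone_order G P" "(y, z) \<in> cone_order G P"
    then have c: "x \<in> carrier G" "y \<in> carrier G" "z \<in> carrier G"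
      by (auto simp: cone_order_def)
    have "(z \<otimes>\<^bsub>G\<^esub> inv\<^bsub>G\<^esub> y) \<otimes>\<^bsub>G\<^esub> (y \<otimes>\<^bsub>G\<^esub> inv\<^bsub>G\<^esub> x) \<in> P"
      using a by (simp add: cone_order_def)
    also have "(z \<otimes>\<^bsub>G\<^esub> inv\<^bsub>G\<^esub> y) \<otimes>\<^bsub>G\<^esub> (y \<otimes>\<^bsub>G\<^esub> inv\<^bsub>G\<^esub> x) = z \<otimes>\<^bsub>G\<^esub> inv\<^bsub>G\<^esub> x"
      using c by (simp add: m_assoc inv_cancel_left)
    finally show "(x, z) \<in> cone_order G P"
      using c by (simp add: cone_order_def)
  qed
  moreover have "(y \<otimes>\<^bsub>G\<^esub> z) \<otimes>\<^bsub>G\<^esub> inv\<^bsub>G\<^esub> (x \<otimes>\<^bsub>G\<^esub> z) = y \<otimes>\<^bsub>G\<^esub> inv\<^bsub>G\<^esub> x"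
    if "x \<in> carrier G" "y \<in> carrier G" "z \<in> carrier G" for x y z
    using that by (simp add: inv_mult_group m_assoc inv_cancel_left)
  ultimately show "right_preorder G (cone_order G P)"
    by (auto simp: right_preorder_def preorder_on_def refl_on_def cone_order_def)
  show "pos_cone G (cone_order G P) = P"
    using P.subset by (auto simp: pos_cone_def cone_order_def)
qed

section \<open>Compatible right-preorders\<close>

locale preordered_action =
  X: group X + B: group B
  for X :: "('a, 'm) monoid_scheme" and B :: "('b, 'n) monoid_scheme" +
  fixes leX :: "'a rel" and leB :: "'b rel" and \<phi> :: "'b \<Rightarrow> 'a \<Rightarrow> 'a"
  assumes leX: "right_preorder X leX" and leB: "right_preorder B leB"
    and action: "group_action_by_auts B X \<phi>"
begin

abbreviation "S \<equiv> semidirect_product X B \<phi>"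
abbreviation "PX \<equiv> pos_cone X leX"
abbreviation "PB \<equiv> pos_cone B leB"

lemma carrier_S: "carrier S = carrier X \<times> carrier B"
  and one_S: "\<one>\<^bsub>S\<^esub> = (\<one>\<^bsub>X\<^esub>, \<one>\<^bsub>B\<^esub>)"
  and mult_S: "(x, b) \<otimes>\<^bsub>S\<^esub> (y, b') = (x \<otimes>\<^bsub>X\<^esub> \<phi> b y, b \<otimes>\<^bsub>B\<^esub> b')"
  by (simp_all add: semidirect_product_def)

lemma action_hom: "\<phi> b \<in> hom X X" if "b \<in> carrier B"
  using action that
  by (auto simp: group_action_by_auts_def hom_def AutoGroup_def auto_def BijGroup_def)

lemma action_closed: "\<phi> b x \<in> carrier X" if "b \<in> carrier B" "x \<in> carrier X"
  using action_hom[OF that(1)] that(2) by (rule hom_in_carrier)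

lemma action_mult: "\<phi> b (x \<otimes>\<^bsub>X\<^esub> y) = \<phi> b x \<otimes>\<^bsub>X\<^esub> \<phi> b y"
  if "b \<in> carrier B" "x \<in> carrier X" "y \<in> carrier X"
  using action_hom[OF that(1)] that(2,3) by (rule hom_mult)

lemma action_one: "\<phi> b \<one>\<^bsub>X\<^esub> = \<one>\<^bsub>X\<^esub>" if "b \<in> carrier B"
  using action_hom[OF that] by (rule hom_one) unfold_locales

lemma action_comp: "\<phi> (b \<otimes>\<^bsub>B\<^esub> b') x = \<phi> b (\<phi> b' x)"
  if "b \<in> carrier B" "b' \<in> carrier B" "x \<in> carrier X"
proof -
  have "\<phi> (b \<otimes>\<^bsub>B\<^esub> b') = \<phi> b \<otimes>\<^bsub>AutoGroup X\<^esub> \<phi> b'" "\<phi> b \<in> Bij (carrier X)" "\<phi> b' \<in> Bij (carrier X)"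
    using action that(1,2)
    by (auto simp: group_action_by_auts_def hom_def AutoGroup_def auto_def BijGroup_def)
  then show ?thesis
    using that(3) by (simp add: AutoGroup_def BijGroup_def compose_eq)
qed

lemma action_by_one: "\<phi> \<one>\<^bsub>B\<^esub> x = x" if "x \<in> carrier X"
proof -
  \<comment> \<open>This unit is the identity function restricted to \<open>carrier X\<close>, so it
    can be evaluated only at elements of the carrier.\<close>
  have "\<phi> \<one>\<^bsub>B\<^esub> = \<one>\<^bsub>AutoGroup X\<^esub>"
    using action B.is_group X.AutoGroup by (intro hom_one) (auto simp: group_action_by_auts_def)
  then show ?thesis
    using that by (simp add: AutoGroup_def BijGroup_def)
qed

lemma group_S: "group S"
proof (rule groupI)
  fix u assume "u \<in> carrier S"
  then obtain x b where u: "u = (x, b)" "x \<in> carrier X" "b \<in> carrier B"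
    by (auto simp: carrier_S)
  \<comment> \<open>The second coordinate of a left inverse must be \<open>inv b\<close>; the first
    then has to cancel \<open>\<phi> (inv b) x\<close>.\<close>
  then have "(\<phi> (inv\<^bsub>B\<^esub> b) (inv\<^bsub>X\<^esub> x), inv\<^bsub>B\<^esub> b) \<otimes>\<^bsub>S\<^esub> u = \<one>\<^bsub>S\<^esub>"
    by (simp add: mult_S one_S action_one flip: action_mult)
  then show "\<exists>v\<in>carrier S. v \<otimes>\<^bsub>S\<^esub> u = \<one>\<^bsub>S\<^esub>"
    using u by (intro bexI) (auto simp: carrier_S action_closed)
qed (auto simp: carrier_S mult_S one_S action_closed action_mult action_comp action_by_one
    X.m_assoc B.m_assoc)

text \<open>The algebraic half of a split extension (homomorphisms, section, kernel of groups) holds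
  automatically. What remains is the order, and monotonicity is read off on cones.\<close>

lemma compatible_iff_pos_cone:
  "compatible X leX B leB \<phi> r \<longleftrightarrow>
     right_preorder S r \<and> snd ` pos_cone S r \<subseteq> PB \<and> (\<forall>b\<in>PB. (\<one>\<^bsub>X\<^esub>, b) \<in> pos_cone S r) \<and>
     (\<forall>x\<in>carrier X. (x, \<one>\<^bsub>B\<^esub>) \<in> pos_cone S r \<longleftrightarrow> x \<in> PX)"
proof -
  have hom: "snd \<in> hom S B" "(\<lambda>b. (\<one>\<^bsub>X\<^esub>, b)) \<in> hom B S" "(\<lambda>x. (x, \<one>\<^bsub>B\<^esub>)) \<in> hom X S"
    by (auto simp: hom_def carrier_S mult_S action_one action_by_one)
  have "(\<lambda>x. (x, \<one>\<^bsub>B\<^esub>)) ` carrier X = kernel S B snd"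
    by (auto simp: kernel_def carrier_S)
  then show ?thesis
    using hom leX leB X.is_group B.is_group group_S
      monotone_map_iff_pos_cone[OF group_S _ B.is_group leB hom(1), of r]
      monotone_map_iff_pos_cone[OF B.is_group leB group_S _ hom(2), of r]
    by (auto simp: compatible_def rordgrp_split_extension_def right_preordered_group_def
        rordgrp_hom_def rordgrp_kernel_def inj_on_def)
qed

text \<open>A positive \<open>b\<close> is either strictly positive or has its inverse in
  \<open>PB\<close>, so the two cases of the definition merge into one implication.\<close>

lemma P_lex_eq:
  "P_lex X leX B leB \<phi> = {(x, b). x \<in> carrier X \<and> b \<in> PB \<and> (inv\<^bsub>B\<^esub> b \<in> PB \<longrightarrow> x \<in> PX)}"
  using equiv_zero_iff_pos_cone[OF B.is_group leB]
  by (auto simp: P_lex_def carrier_S strictly_pos_def pos_cone_def equiv_zero_def)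

text \<open>If the product is equivalent to zero, its inverse is positive, hence so is that of the
  factor \<open>b\<close>. Conversely \<open>inv b\<close> itself serves as
  \<open>b'\<close>.\<close>

lemma equiv_zero_mult_iff:
  assumes "b \<in> PB"
  shows "(\<exists>b'\<in>PB. equiv_zero B leB (b \<otimes>\<^bsub>B\<^esub> b')) \<longleftrightarrow> inv\<^bsub>B\<^esub> b \<in> PB"
proof
  assume "\<exists>b'\<in>PB. equiv_zero B leB (b \<otimes>\<^bsub>B\<^esub> b')"
  then obtain b' where b': "b' \<in> PB" "equiv_zero B leB (b \<otimes>\<^bsub>B\<^esub> b')"
    by blast
  then have "inv\<^bsub>B\<^esub> (b \<otimes>\<^bsub>B\<^esub> b') \<in> PB"
    using equiv_zero_iff_pos_cone[OF B.is_group leB] B.m_closed pos_cone_carrier assms by metis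
  with b'(1) show "inv\<^bsub>B\<^esub> b \<in> PB"
    by (rule pos_cone_inv_of_mult(1)[OF B.is_group leB assms])
next
  assume inv: "inv\<^bsub>B\<^esub> b \<in> PB"
  have "equiv_zero B leB (b \<otimes>\<^bsub>B\<^esub> inv\<^bsub>B\<^esub> b)"
    using submonoid.one_closed[OF submonoid_pos_cone[OF B.is_group leB]]
      equiv_zero_iff_pos_cone[OF B.is_group leB B.one_closed] pos_cone_carrier[OF assms]
    by simp
  with inv show "\<exists>b'\<in>PB. equiv_zero B leB (b \<otimes>\<^bsub>B\<^esub> b')"
    by blast
qed

lemma action_monotone_if_compatible:
  assumes "compatible X leX B leB \<phi> r" "b \<in> PB" "inv\<^bsub>B\<^esub> b \<in> PB"
  shows "\<phi> b ` PX \<subseteq> PX"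
proof (rule image_subsetI)
  fix x assume x: "x \<in> PX"
  note c = pos_cone_carrier[OF assms(2)] pos_cone_carrier[OF x]
  note compat = assms(1)[unfolded compatible_iff_pos_cone]
  have r: "right_preorder S r"
    using compat by blast
  have "(\<one>\<^bsub>X\<^esub>, b) \<in> pos_cone S r" "(x, \<one>\<^bsub>B\<^esub>) \<in> pos_cone S r" "(\<one>\<^bsub>X\<^esub>, inv\<^bsub>B\<^esub> b) \<in> pos_cone S r"
    using compat assms(2,3) x c by blast+
  \<comment> \<open>The outer factors are mutually inverse values of the section, so this is a
    conjugate of \<open>(x, \<one>)\<close> and lies in the kernel of the projection.\<close>
  then have "(\<one>\<^bsub>X\<^esub>, b) \<otimes>\<^bsub>S\<^esub> (x, \<one>\<^bsub>B\<^esub>) \<otimes>\<^bsub>S\<^esub> (\<one>\<^bsub>X\<^esub>, inv\<^bsub>B\<^esub> b) \<in> pos_cone S r"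
    using submonoid.m_closed[OF submonoid_pos_cone[OF group_S r]] by blast
  also have "(\<one>\<^bsub>X\<^esub>, b) \<otimes>\<^bsub>S\<^esub> (x, \<one>\<^bsub>B\<^esub>) \<otimes>\<^bsub>S\<^esub> (\<one>\<^bsub>X\<^esub>, inv\<^bsub>B\<^esub> b) = (\<phi> b x, \<one>\<^bsub>B\<^esub>)"
    using c by (simp add: mult_S action_one action_closed)
  finally show "\<phi> b x \<in> PX"
    using compat c action_closed by blast
qed

lemma submonoid_P_lex:
  assumes "\<And>b. b \<in> PB \<Longrightarrow> inv\<^bsub>B\<^esub> b \<in> PB \<Longrightarrow> \<phi> b ` PX \<subseteq> PX"
  shows "submonoid (P_lex X leX B leB \<phi>) S"
proof
  note PX = submonoid_pos_cone[OF X.is_group leX]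
  note PB = submonoid_pos_cone[OF B.is_group leB]
  show "P_lex X leX B leB \<phi> \<subseteq> carrier S"
    by (auto simp: P_lex_eq carrier_S dest: pos_cone_carrier)
  show "\<one>\<^bsub>S\<^esub> \<in> P_lex X leX B leB \<phi>"
    using submonoid.one_closed[OF PX] submonoid.one_closed[OF PB] by (simp add: P_lex_eq one_S)
  fix u v assume "u \<in> P_lex X leX B leB \<phi>" "v \<in> P_lex X leX B leB \<phi>"
  then obtain x b y b' where u: "u = (x, b)" "x \<in> carrier X" "b \<in> PB" "inv\<^bsub>B\<^esub> b \<in> PB \<Longrightarrow> x \<in> PX"
    and v: "v = (y, b')" "y \<in> carrier X" "b' \<in> PB" "inv\<^bsub>B\<^esub> b' \<in> PB \<Longrightarrow> y \<in> PX"
    unfolding P_lex_eq by blast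
  \<comment> \<open>The first coordinate is constrained only when \<open>b \<otimes> b'\<close> is
    invertible within \<open>PB\<close>. Then \<open>b\<close> and \<open>b'\<close> are too, so
    \<open>x\<close> and \<open>y\<close> are positive and the assumption applies to
    \<open>\<phi> b\<close>.\<close>
  have "x \<otimes>\<^bsub>X\<^esub> \<phi> b y \<in> PX" if inv: "inv\<^bsub>B\<^esub> (b \<otimes>\<^bsub>B\<^esub> b') \<in> PB"
  proof (rule submonoid.m_closed[OF PX])
    note inv = pos_cone_inv_of_mult[OF B.is_group leB u(3) v(3) inv]
    show "x \<in> PX"
      using inv(1) by (rule u(4))
    show "\<phi> b y \<in> PX"
      using assms[OF u(3) inv(1)] v(4)[OF inv(2)] by blast
  qed
  moreover have "b \<otimes>\<^bsub>B\<^esub> b' \<in> PB"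
    using u(3) v(3) by (rule submonoid.m_closed[OF PB])
  moreover have "x \<otimes>\<^bsub>X\<^esub> \<phi> b y \<in> carrier X"
    using u(2) v(2) action_closed[OF pos_cone_carrier[OF u(3)]] by simp
  ultimately show "u \<otimes>\<^bsub>S\<^esub> v \<in> P_lex X leX B leB \<phi>"
    by (simp add: P_lex_eq u(1) v(1) mult_S)
qed

text \<open>The section lands in \<open>P_lex\<close> since \<open>\<one>\<close> is positive in
  \<open>X\<close>. On the kernel \<open>b\<close> is \<open>\<one>\<close>, whose inverse is
  positive, so the implication in \<open>P_lex_eq\<close> forces exactly
  \<open>x \<in> PX\<close>.\<close>

lemma compatible_P_lex:
  assumes "\<And>b. b \<in> PB \<Longrightarrow> inv\<^bsub>B\<^esub> b \<in> PB \<Longrightarrow> \<phi> b ` PX \<subseteq> PX"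
  shows "compatible X leX B leB \<phi> (cone_order S (P_lex X leX B leB \<phi>))"
proof -
  have P: "submonoid (P_lex X leX B leB \<phi>) S"
    using assms by (rule submonoid_P_lex)
  show ?thesis
    unfolding compatible_iff_pos_cone pos_cone_cone_order[OF group_S P]
    using right_preorder_cone_order[OF group_S P]
      submonoid.one_closed[OF submonoid_pos_cone[OF X.is_group leX]]
      submonoid.one_closed[OF submonoid_pos_cone[OF B.is_group leB]]
    by (auto simp: P_lex_eq)
qed

end

theorem theorem4p2:
  fixes X :: "('a, 'm) monoid_scheme" and leX :: "'a rel"
    and B :: "('b, 'n) monoid_scheme" and leB :: "'b rel"
    and \<phi> :: "'b \<Rightarrow> 'a \<Rightarrow> 'a"
  assumes "right_preordered_group X leX"
    and "right_preordered_group B leB"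
    and "group_action_by_auts B X \<phi>"
  shows "((\<exists>r. compatible X leX B leB \<phi> r \<and>
              pos_cone (semidirect_product X B \<phi>) r = P_lex X leX B leB \<phi>)
          \<longleftrightarrow> (\<exists>r. compatible X leX B leB \<phi> r))
       \<and> ((\<exists>r. compatible X leX B leB \<phi> r)
          \<longleftrightarrow> (\<forall>b\<in>pos_cone B leB.
                (\<exists>b'\<in>pos_cone B leB. equiv_zero B leB (b \<otimes>\<^bsub>B\<^esub> b'))
                  \<longrightarrow> monotone_map X leX leX (\<phi> b)))"
proof -
  interpret preordered_action X B leX leB \<phi>
    using assms
    by (simp add: preordered_action_def preordered_action_axioms_def right_preordered_group_def)
  let ?mono = "\<forall>b\<in>PB. inv\<^bsub>B\<^esub> b \<in> PB \<longrightarrow> \<phi> b ` PX \<subseteq> PX"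
  have "monotone_map X leX leX (\<phi> b) \<longleftrightarrow> \<phi> b ` PX \<subseteq> PX" if "b \<in> PB" for b
    using that X.is_group leX action_hom
    by (intro monotone_map_iff_pos_cone) (auto simp: pos_cone_def)
  then have iii: "(\<forall>b\<in>PB. (\<exists>b'\<in>PB. equiv_zero B leB (b \<otimes>\<^bsub>B\<^esub> b')) \<longrightarrow> monotone_map X leX leX (\<phi> b))
      \<longleftrightarrow> ?mono"
    by (simp add: equiv_zero_mult_iff)
  \<comment> \<open>The two implications shown are (ii) to (iii) and (iii) to (i); the one from (i)
    to (ii) just forgets which cone the witness has.\<close>
  have "?mono" if "compatible X leX B leB \<phi> r" for r
    using action_monotone_if_compatible[OF that] by blast
  moreover have "\<exists>r. compatible X leX B leB \<phi> r \<and> pos_cone S r = P_lex X leX B leB \<phi>" if ?mono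
    using that compatible_P_lex pos_cone_cone_order[OF group_S submonoid_P_lex] by blast
  ultimately show ?thesis
    unfolding iii by blast
qed

end
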